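(* Let $(a_{ij})_{(i,j)\in\mathbb{Z}^2}$ be the left light cone coordinates of the boundary points associated with the edges of a string world sheet in $AdS_3$ built up from string segments, and suppose that for each $(i,j)$ either $a_{ij}<a_{i,j+1},a_{i,j-1},a_{i-1,j},a_{i+1,j}$ (positively oriented edge) or $a_{ij}>a_{i,j+1},a_{i,j-1},a_{i-1,j},a_{i+1,j}$ (negatively oriented edge). Suppose that the discretized Nambu–Goto action is stationary under variations of each $a_{ij}$. Then for all $(i,j)$ the left components of the boundary entanglement entropies, $S^L(ij,kl)=\frac{c}{6}\log\frac{|a_{ij}-a_{kl}|}{\delta}$, satisfy $$e^{-\frac{6}{c}S^L(ij,\,i\,j+1)}+e^{-\frac{6}{c}S^L(ij,\,i\,j-1)}=e^{-\frac{6}{c}S^L(ij,\,i+1\,j)}+e^{-\frac{6}{c}S^L(ij,\,i-1\,j)} .$$ The same equation holds for the right components $S^R(ij,kl)=\frac{c}{6}\log\frac{|\tilde a_{ij}-\tilde a_{kl}|}{\delta}$, under the analogous assumptions on the right light cone coordinates $\tilde a_{ij}$.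
   Context: The edges of the segmented string are labelled by null vectors $p_{ij}\in\mathbb{R}^{2,2}$ (coordinates $p^{-1},p^0,p^1,p^2$), and $a_{ij}=L\frac{p_{ij}^0+p_{ij}^2}{p_{ij}^1-p_{ij}^{-1}}$, $\tilde a_{ij}=L\frac{p_{ij}^0-p_{ij}^2}{p_{ij}^1-p_{ij}^{-1}}$ are real numbers, with $L>0$ the AdS radius. The discretized Nambu–Goto action is (up to an overall constant factor) $$A_{\mathrm{tot}}=\sum_{i,j}\log\left|\frac{a_{i,j}-a_{i,j+1}}{a_{i,j}-a_{i+1,j}}\right|+\sum_{i,j}\log\left|\frac{\tilde a_{i,j}-\tilde a_{i,j+1}}{\tilde a_{i,j}-\tilde a_{i+1,j}}\right| .$$ Stationarity with respect to $a_{ij}$ (resp. $\tilde a_{ij}$) means that the derivative with respect to $a_{ij}$ (resp. $\tilde a_{ij}$), with all other variables fixed, of the sum of the finitely many terms containing that variable vanishes. Here $a_{ij}$ and $\tilde a_{ij}$ are treated as independent variables. $c>0$ is the central charge and $\delta>0$ a UV cutoff. *)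

theory Defs
  imports "HOL-Analysis.Analysis"
begin

text \<open>Vectors of \<open>\<real>\<^sup>2\<^sup>,\<^sup>2\<close> are rendered as \<^typ>\<open>real^4\<close>.  The index type \<open>4\<close> is the ring of
  integers modulo 4, so that \<open>-1\<close>, \<open>0\<close>, \<open>1\<close>, \<open>2\<close> are precisely its four elements (\<open>-1\<close> being \<open>3\<close>).
  The components \<open>-1\<close> and \<open>0\<close> are timelike: radius-\<open>L\<close> AdS is \<open>X \<cdot> X = -L\<^sup>2\<close>.\<close>

definition inner22 :: "real^4 \<Rightarrow> real^4 \<Rightarrow> real" where
  "inner22 x y = - (x $ (-1) * y $ (-1)) - x $ 0 * y $ 0 + x $ 1 * y $ 1 + x $ 2 * y $ 2"

definition null_vector :: "real^4 \<Rightarrow> bool" where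
  "null_vector p \<longleftrightarrow> p \<noteq> 0 \<and> inner22 p p = 0"

text \<open>Meaningful only if \<open>p\<^sup>1 \<noteq> p\<^sup>-\<^sup>1\<close>, i.e. if the boundary point is not at infinity.\<close>

definition left_coord :: "real \<Rightarrow> (int \<times> int \<Rightarrow> real^4) \<Rightarrow> int \<times> int \<Rightarrow> real" where
  "left_coord L p = (\<lambda>e. L * ((p e $ 0 + p e $ 2) / (p e $ 1 - p e $ (-1))))"

definition right_coord :: "real \<Rightarrow> (int \<times> int \<Rightarrow> real^4) \<Rightarrow> int \<times> int \<Rightarrow> real" where
  "right_coord L p = (\<lambda>e. L * ((p e $ 0 - p e $ 2) / (p e $ 1 - p e $ (-1))))"

definition action_term :: "(int \<times> int \<Rightarrow> real) \<Rightarrow> int \<times> int \<Rightarrow> real" where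
  "action_term a = (\<lambda>(i, j). ln \<bar>(a (i, j) - a (i, j + 1)) / (a (i, j) - a (i + 1, j))\<bar>)"

text \<open>The total action is a formal sum over the whole lattice; \<open>NG_action K\<close> is its part
  with index set \<open>K\<close>.\<close>

definition NG_action ::
  "(int \<times> int) set \<Rightarrow> (int \<times> int \<Rightarrow> real) \<Rightarrow> (int \<times> int \<Rightarrow> real) \<Rightarrow> real" where
  "NG_action K a a' = (\<Sum>e\<in>K. action_term a e) + (\<Sum>e\<in>K. action_term a' e)"

text \<open>The (three) indices whose summand involves the variable at a given edge.\<close>

definition terms_at :: "int \<times> int \<Rightarrow> (int \<times> int) set" where
  "terms_at e = {(k, l). e \<in> {(k, l), (k, l + 1), (k + 1, l)}}"

text \<open>The two sequences of variables are independent: when one of them is varied, the summands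
  in the other one are constant and do not affect the derivative.\<close>

definition stationary_left :: "(int \<times> int \<Rightarrow> real) \<Rightarrow> (int \<times> int \<Rightarrow> real) \<Rightarrow> bool" where
  "stationary_left a a' \<longleftrightarrow>
     (\<forall>e. ((\<lambda>t. NG_action (terms_at e) (a(e := t)) a') has_real_derivative 0) (at (a e)))"

definition stationary_right :: "(int \<times> int \<Rightarrow> real) \<Rightarrow> (int \<times> int \<Rightarrow> real) \<Rightarrow> bool" where
  "stationary_right a a' \<longleftrightarrow>
     (\<forall>e. ((\<lambda>t. NG_action (terms_at e) a (a'(e := t))) has_real_derivative 0) (at (a' e)))"

definition positively_oriented :: "(int \<times> int \<Rightarrow> real) \<Rightarrow> int \<times> int \<Rightarrow> bool" where
  "positively_oriented a = (\<lambda>(i, j).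
     a (i, j) < a (i, j + 1) \<and> a (i, j) < a (i, j - 1) \<and>
     a (i, j) < a (i - 1, j) \<and> a (i, j) < a (i + 1, j))"

definition negatively_oriented :: "(int \<times> int \<Rightarrow> real) \<Rightarrow> int \<times> int \<Rightarrow> bool" where
  "negatively_oriented a = (\<lambda>(i, j).
     a (i, j) > a (i, j + 1) \<and> a (i, j) > a (i, j - 1) \<and>
     a (i, j) > a (i - 1, j) \<and> a (i, j) > a (i + 1, j))"

text \<open>\<open>S\<^sup>L\<close> for left and \<open>S\<^sup>R\<close> for right light cone coordinates.\<close>

definition entropy :: "real \<Rightarrow> real \<Rightarrow> (int \<times> int \<Rightarrow> real) \<Rightarrow> int \<times> int \<Rightarrow> int \<times> int \<Rightarrow> real" where
  "entropy c \<delta> a e e' = c / 6 * ln (\<bar>a e - a e'\<bar> / \<delta>)"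

definition entropy_equation :: "real \<Rightarrow> (int \<times> int \<Rightarrow> int \<times> int \<Rightarrow> real) \<Rightarrow> bool" where
  "entropy_equation c S \<longleftrightarrow> (\<forall>i j.
     exp (- (6 / c) * S (i, j) (i, j + 1)) + exp (- (6 / c) * S (i, j) (i, j - 1)) =
     exp (- (6 / c) * S (i, j) (i + 1, j)) + exp (- (6 / c) * S (i, j) (i - 1, j)))"

end

theory Submission imports Defs begin

text \<open>The variable at \<open>e = (i, j)\<close> enters the action through
  \<open>ln \<bar>a e - a (i, j \<plusminus> 1)\<bar> - ln \<bar>a e - a (i \<plusminus> 1, j)\<bar>\<close>, so stationarity balances the reciprocals of
  the signed differences. By the orientation hypothesis the four differences at an edge have a
  common sign and may be replaced by their absolute values, and \<open>1 / \<bar>a e - a e'\<bar>\<close> is, up to the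
  factor \<open>\<delta>\<close>, the exponential of \<open>- (6 / c)\<close> times the entropy.\<close>

text \<open>Logarithmic differentiation. The absolute value leaves no trace, because
  \<open>ln \<bar>y\<bar>\<close> has derivative \<open>1 / y\<close> on both sides of zero.\<close>

lemma DERIV_ln_abs_divide:
  fixes f g :: "real \<Rightarrow> real"
  assumes f: "(f has_real_derivative f') (at x)" "f x \<noteq> 0"
    and g: "(g has_real_derivative g') (at x)" "g x \<noteq> 0"
  shows "((\<lambda>t. ln \<bar>f t / g t\<bar>) has_real_derivative f' / f x - g' / g x) (at x)"
proof -
  have q: "((\<lambda>t. f t / g t) has_real_derivative (f' * g x - f x * g') / (g x * g x)) (at x)"
    using DERIV_divide[OF f(1) g] .
  have "((\<lambda>y::real. ln \<bar>y\<bar>) has_real_derivative 1 / y) (at y)" if "y \<noteq> 0" for y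
  proof (cases "y > 0")
    case True
    then show ?thesis
      by (simp add: abs_if ln_minus if_distrib DERIV_ln_divide cong: if_cong)
  next
    \<comment> \<open>Here \<open>- y\<close> is positive, so \<open>ln (- y)\<close> can be
      differentiated, and the two minus signs cancel.\<close>
    case False
    have "((\<lambda>y. ln (- y)) has_real_derivative 1 / y) (at y)"
      using False that by (auto intro!: derivative_eq_intros)
    then show ?thesis
      by (simp add: abs_if ln_minus if_distrib cong: if_cong)
  qed
  from DERIV_chain2[OF this q] f(2) g(2) show ?thesis
    by (auto elim!: DERIV_cong simp: field_simps simp del: abs_divide)
qed

lemma terms_at_eq: "terms_at (i, j) = {(i, j), (i, j - 1), (i - 1, j)}"
  by (auto simp: terms_at_def)

lemma oriented_neighbours_distinct:
  assumes "\<And>e. positively_oriented a e \<or> negatively_oriented a e"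
  shows "a (i, j) \<noteq> a (i, j + 1)" "a (i, j) \<noteq> a (i, j - 1)"
    "a (i, j) \<noteq> a (i + 1, j)" "a (i, j) \<noteq> a (i - 1, j)"
  using assms[of "(i, j)"] by (auto simp: positively_oriented_def negatively_oriented_def)

text \<open>The summand based at \<open>(i, j)\<close> contributes both forward neighbours; those
  based at \<open>(i, j - 1)\<close> and \<open>(i - 1, j)\<close> contribute the backward
  ones.\<close>

lemma NG_action_has_derivative:
  assumes "\<And>e. positively_oriented a e \<or> negatively_oriented a e"
  shows "((\<lambda>t. NG_action (terms_at (i, j)) (a((i, j) := t)) a') has_real_derivative
     1 / (a (i, j) - a (i, j + 1)) + 1 / (a (i, j) - a (i, j - 1))
       - 1 / (a (i, j) - a (i + 1, j)) - 1 / (a (i, j) - a (i - 1, j))) (at (a (i, j)))"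
proof -
  note ne = oriented_neighbours_distinct[OF assms]
  let ?x = "a (i, j)"
  have d1: "((\<lambda>t. ln \<bar>(t - a (i, j + 1)) / (t - a (i + 1, j))\<bar>) has_real_derivative
      1 / (?x - a (i, j + 1)) - 1 / (?x - a (i + 1, j))) (at ?x)"
    by (rule DERIV_ln_abs_divide) (use ne[of i j] in \<open>auto intro!: derivative_eq_intros\<close>)
  \<comment> \<open>The variable moves only in the numerator. The fixed denominator is nonzero by
    the orientation at \<open>(i, j - 1)\<close>.\<close>
  have d2: "((\<lambda>t. ln \<bar>(a (i, j - 1) - t) / (a (i, j - 1) - a (i + 1, j - 1))\<bar>) has_real_derivative
      - 1 / (a (i, j - 1) - ?x) - 0 / (a (i, j - 1) - a (i + 1, j - 1))) (at ?x)"
    by (rule DERIV_ln_abs_divide)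
      (use ne[of i j] ne[of i "j - 1"] in \<open>auto intro!: derivative_eq_intros\<close>)
  have d3: "((\<lambda>t. ln \<bar>(a (i - 1, j) - a (i - 1, j + 1)) / (a (i - 1, j) - t)\<bar>) has_real_derivative
      0 / (a (i - 1, j) - a (i - 1, j + 1)) - - 1 / (a (i - 1, j) - ?x)) (at ?x)"
    by (rule DERIV_ln_abs_divide)
      (use ne[of i j] ne[of "i - 1" j] in \<open>auto intro!: derivative_eq_intros\<close>)
  have terms: "NG_action (terms_at (i, j)) (a((i, j) := t)) a' =
      ln \<bar>(t - a (i, j + 1)) / (t - a (i + 1, j))\<bar>
      + (ln \<bar>(a (i, j - 1) - t) / (a (i, j - 1) - a (i + 1, j - 1))\<bar>
      + ln \<bar>(a (i - 1, j) - a (i - 1, j + 1)) / (a (i - 1, j) - t)\<bar>)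
      + (\<Sum>e\<in>terms_at (i, j). action_term a' e)" for t
    by (simp add: NG_action_def terms_at_eq action_term_def)
  \<comment> \<open>The backward summands produce their differences in reversed order.\<close>
  have swap: "1 / (y - ?x) = - (1 / (?x - y))" for y
    by (metis minus_diff_eq minus_divide_right)
  show ?thesis
    unfolding terms
    by (rule DERIV_cong[OF DERIV_add[OF DERIV_add[OF d1 DERIV_add[OF d2 d3]] DERIV_const]])
      (simp add: swap[of "a (i, j - 1)"] swap[of "a (i - 1, j)"])
qed

text \<open>The factors \<open>6 / c\<close> and \<open>c / 6\<close> cancel, leaving the reciprocal
  of a positive number under \<open>exp\<close> and \<open>ln\<close>.\<close>

lemma exp_entropy:
  assumes "c > 0" "\<delta> > 0" "a e \<noteq> a e'"
  shows "exp (- (6 / c) * entropy c \<delta> a e e') = \<delta> / \<bar>a e - a e'\<bar>"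
  using assms by (simp add: entropy_def exp_minus)

lemma stationary_left_imp_entropy_equation:
  assumes "c > 0" "\<delta> > 0"
    and oriented: "\<And>e. positively_oriented a e \<or> negatively_oriented a e"
    and "stationary_left a a'"
  shows "entropy_equation c (entropy c \<delta> a)"
  unfolding entropy_equation_def
proof (intro allI)
  fix i j
  let ?x = "a (i, j)"
  have "1 / (?x - a (i, j + 1)) + 1 / (?x - a (i, j - 1))
      - 1 / (?x - a (i + 1, j)) - 1 / (?x - a (i - 1, j)) = 0"
    using DERIV_unique[OF NG_action_has_derivative[OF oriented]] \<open>stationary_left a a'\<close>
    unfolding stationary_left_def by blast
  then have "\<delta> * (1 / (?x - a (i, j + 1)) + 1 / (?x - a (i, j - 1))) =
      \<delta> * (1 / (?x - a (i + 1, j)) + 1 / (?x - a (i - 1, j)))"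
    by (intro arg_cong[of _ _ "(*) \<delta>"]) linarith
  then have bal: "\<delta> / (?x - a (i, j + 1)) + \<delta> / (?x - a (i, j - 1)) =
      \<delta> / (?x - a (i + 1, j)) + \<delta> / (?x - a (i - 1, j))"
    by (simp only: distrib_left times_divide_eq_right mult_1_right)
  \<comment> \<open>At a positively oriented edge all four differences in \<open>bal\<close> are
    negative, so both sides change sign.\<close>
  have neg: "\<delta> / (y - z) = - (\<delta> / (z - y))" for y z
    by (metis minus_diff_eq minus_divide_right)
  have "\<delta> / \<bar>?x - a (i, j + 1)\<bar> + \<delta> / \<bar>?x - a (i, j - 1)\<bar> =
      \<delta> / \<bar>?x - a (i + 1, j)\<bar> + \<delta> / \<bar>?x - a (i - 1, j)\<bar>"
    using oriented[of "(i, j)"]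
  proof
    assume "positively_oriented a (i, j)"
    then show ?thesis
      using bal by (simp add: positively_oriented_def neg[of ?x])
  next
    assume "negatively_oriented a (i, j)"
    then show ?thesis
      using bal by (simp add: negatively_oriented_def)
  qed
  then show "exp (- (6 / c) * entropy c \<delta> a (i, j) (i, j + 1)) +
      exp (- (6 / c) * entropy c \<delta> a (i, j) (i, j - 1)) =
      exp (- (6 / c) * entropy c \<delta> a (i, j) (i + 1, j)) +
      exp (- (6 / c) * entropy c \<delta> a (i, j) (i - 1, j))"
    using oriented_neighbours_distinct[OF oriented, of i j] assms(1,2)
    by (simp only: exp_entropy not_False_eq_True)
qed

text \<open>The action is symmetric in its two families of variables, which reduces the right
  components to the left ones.\<close>

lemma stationary_right_iff: "stationary_right a a' \<longleftrightarrow> stationary_left a' a"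
  by (simp add: stationary_right_def stationary_left_def NG_action_def add.commute)

theorem mainTheorem7:
  fixes p :: "int \<times> int \<Rightarrow> real^4" and a a' :: "int \<times> int \<Rightarrow> real" and L c \<delta> :: real
  assumes "L > 0" and "c > 0" and "\<delta> > 0"
    and "\<And>e. null_vector (p e)"
    and "\<And>e. p e $ 1 \<noteq> p e $ (-1)"
    and "a = left_coord L p" and "a' = right_coord L p"
  shows "((\<forall>e. positively_oriented a e \<or> negatively_oriented a e) \<and> stationary_left a a'
            \<longrightarrow> entropy_equation c (entropy c \<delta> a)) \<and>
         ((\<forall>e. positively_oriented a' e \<or> negatively_oriented a' e) \<and> stationary_right a a'
            \<longrightarrow> entropy_equation c (entropy c \<delta> a'))"
  using stationary_left_imp_entropy_equation[OF assms(2,3)] by (auto simp: stationary_right_iff)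

end
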